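(* Let $U \subseteq \mathbb{R}^K$ be open and convex, and let $Q : U \to \mathbb{R}^K$ be differentiable and satisfy the law of demand. Then the following are equivalent for arbitrary $u \in U$: (i) For any $\tilde{u} \in U$ with $u \neq \tilde{u}$, $Q(u) \neq Q(\tilde{u})$. (ii) $Q$ is locally injective at $u$. (iii) The only line segment in $U$ that contains $u$ and over which $Q$ is constant is the point $u$. (iv) There are no nonzero vectors $v \in \mathbb{R}^K$ such that for all $\lambda \in [0,1]$ satisfying $u + \lambda v \in U$, $Q'(u + \lambda v, v)$ is the zero vector.
   Context: A mapping $Q : U \subseteq \mathbb{R}^K \to \mathbb{R}^K$ satisfies the law of demand if for all $u, \tilde{u} \in U$, $(Q(u) - Q(\tilde{u})) \cdot (u - \tilde{u}) \geq 0$. $Q$ is locally injective at $u$ if there is a neighborhood $N \subseteq U$ of $u$ such that the restriction of $Q$ to $N$ is injective. A line segment is a set $\{(1-\alpha) a + \alpha b : \alpha \in [0,1]\}$ with $a, b \in \mathbb{R}^K$ (possibly $a=b$, a point). The directional derivative of $Q$ at $w$ in direction $v$ is $Q'(w, v) = \lim_{\lambda \downarrow 0} \frac{Q(w + \lambda v) - Q(w)}{\lambda}$, whenever this limit exists. Differentiable means differentiable at every point of $U$ (the derivative is not assumed continuous).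
   Formalization: At a single u, (i) does not imply (ii): e.g. Q(x)=∫_0^x max(0,t² sin(1/t))dt at 0. Proved: (i)⇔(iii)⇔(iv) and (ii)⇒(i) at each u; (i)⇔(ii) at each u if (ii) only says Q(u) is not repeated near u; and all four equivalent when each is required at every u in U. *)

theory Defs
  imports "HOL-Analysis.Analysis"
begin

(* A map Q : U -> R^K is a total function together with its domain U; the values of Q
   outside U play no role below, since U is open wherever a limit is taken. *)

definition law_of_demand :: "('a::euclidean_space) set \<Rightarrow> ('a \<Rightarrow> 'a) \<Rightarrow> bool" where
  "law_of_demand U Q \<longleftrightarrow> (\<forall>u\<in>U. \<forall>u'\<in>U. (Q u - Q u') \<bullet> (u - u') \<ge> 0)"

definition uniquely_valued_at :: "('a::euclidean_space) set \<Rightarrow> ('a \<Rightarrow> 'a) \<Rightarrow> 'a \<Rightarrow> bool" where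
  "uniquely_valued_at U Q u \<longleftrightarrow> (\<forall>u'\<in>U. u \<noteq> u' \<longrightarrow> Q u \<noteq> Q u')"

definition locally_injective_at :: "('a::euclidean_space) set \<Rightarrow> ('a \<Rightarrow> 'a) \<Rightarrow> 'a \<Rightarrow> bool" where
  "locally_injective_at U Q u \<longleftrightarrow> (\<exists>N. N \<subseteq> U \<and> u \<in> interior N \<and> inj_on Q N)"

(* Strictly weaker than local injectivity at u: only the value Q u itself must not be
   repeated in N, while Q may identify other points of N with each other. *)
definition locally_uniquely_valued_at :: "('a::euclidean_space) set \<Rightarrow> ('a \<Rightarrow> 'a) \<Rightarrow> 'a \<Rightarrow> bool" where
  "locally_uniquely_valued_at U Q u \<longleftrightarrow>
     (\<exists>N. N \<subseteq> U \<and> u \<in> interior N \<and> uniquely_valued_at N Q u)"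

(* Degenerate segments (a = b) are included, so the point u is always one of them. *)
definition only_trivial_constant_segment_at :: "('a::euclidean_space) set \<Rightarrow> ('a \<Rightarrow> 'a) \<Rightarrow> 'a \<Rightarrow> bool" where
  "only_trivial_constant_segment_at U Q u \<longleftrightarrow>
     {S. (\<exists>a b. S = closed_segment a b) \<and> S \<subseteq> U \<and> u \<in> S \<and> Q constant_on S} = {{u}}"

(* Q'(w, v) exists and equals d *)
definition has_directional_derivative ::
    "('a::euclidean_space \<Rightarrow> 'a) \<Rightarrow> 'a \<Rightarrow> 'a \<Rightarrow> 'a \<Rightarrow> bool" where
  "has_directional_derivative Q w v d \<longleftrightarrow>
     ((\<lambda>t. (Q (w + t *\<^sub>R v) - Q w) /\<^sub>R t) \<longlongrightarrow> d) (at_right 0)"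

definition no_null_direction_at :: "('a::euclidean_space) set \<Rightarrow> ('a \<Rightarrow> 'a) \<Rightarrow> 'a \<Rightarrow> bool" where
  "no_null_direction_at U Q u \<longleftrightarrow>
     \<not> (\<exists>v. v \<noteq> 0 \<and> (\<forall>t\<in>{0..1}. u + t *\<^sub>R v \<in> U \<longrightarrow>
              has_directional_derivative Q (u + t *\<^sub>R v) v 0))"

end

(* By Minty's argument the level sets of a continuous monotone map on an open convex set are
   convex. Hence a second point with value Q u makes Q constant on a whole segment starting at u,
   which yields repeated values arbitrarily close to u and a null direction. Conversely, along a
   null direction the restriction of Q to a short segment has zero derivative, so it is constant. *)

theory Submission
  imports Defs
begin

section \<open>Level sets of monotone maps\<close>

text \<open>Minty's trick: the nonlinear equation in \<open>w\<close> is traded for a family of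
  inequalities indexed by \<open>z\<close>, each affine in \<open>w\<close>. Monotonicity gives them
  at once; for the converse they are tested at points \<open>z\<close> approaching \<open>w\<close>
  along a suitable ray, and continuity passes to the limit.\<close>

lemma minty_level_set:
  fixes Q :: "'a::euclidean_space \<Rightarrow> 'a"
  assumes U: "open U" and cont: "continuous_on U Q" and mono: "law_of_demand U Q"
    and u: "u \<in> U" and w: "w \<in> U"
  shows "Q w = Q u \<longleftrightarrow> (\<forall>z\<in>U. (Q z - Q u) \<bullet> (z - w) \<ge> 0)"
proof
  assume "Q w = Q u"
  then show "\<forall>z\<in>U. (Q z - Q u) \<bullet> (z - w) \<ge> 0"
    using mono w by (metis law_of_demand_def)
next
  assume ineq: "\<forall>z\<in>U. (Q z - Q u) \<bullet> (z - w) \<ge> 0"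
  \<comment> \<open>This direction turns the limit inequality
    \<open>(Q w - Q u) \<bullet> h \<ge> 0\<close> into \<open>- (h \<bullet> h) \<ge> 0\<close>,
    which forces \<open>h = 0\<close>.\<close>
  define h where "h = Q u - Q w"
  have line: "((\<lambda>t. w + t *\<^sub>R h) \<longlongrightarrow> w) (at_right 0)"
    by (auto intro!: tendsto_eq_intros)
  have "isCont Q w"
    using U cont w continuous_on_eq_continuous_at by blast
  then have "((\<lambda>t. Q (w + t *\<^sub>R h)) \<longlongrightarrow> Q w) (at_right 0)"
    using line by (rule isCont_tendsto_compose)
  then have "((\<lambda>t. (Q (w + t *\<^sub>R h) - Q u) \<bullet> h) \<longlongrightarrow> (Q w - Q u) \<bullet> h) (at_right 0)"
    by (intro tendsto_intros)
  moreover have "\<forall>\<^sub>F t in at_right 0. (Q (w + t *\<^sub>R h) - Q u) \<bullet> h \<ge> 0"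
    using topological_tendstoD[OF line U w] eventually_at_right_less[of 0]
  proof eventually_elim
    case (elim t)
    \<comment> \<open>For \<open>z = w + t *\<^sub>R h\<close> the difference \<open>z - w\<close>
      is \<open>t *\<^sub>R h\<close>; the factor \<open>t > 0\<close> is then cancelled before the
      limit is taken.\<close>
    then have "t * ((Q (w + t *\<^sub>R h) - Q u) \<bullet> h) \<ge> 0"
      using ineq by force
    with elim show ?case
      by (simp add: zero_le_mult_iff)
  qed
  ultimately have "(Q w - Q u) \<bullet> h \<ge> 0"
    by (rule tendsto_lowerbound) simp
  then have "h \<bullet> h \<le> 0"
    by (simp add: h_def inner_diff_left)
  then have "h = 0"
    by (metis inner_gt_zero_iff not_le)
  then show "Q w = Q u"
    by (simp add: h_def)
qed

text \<open>For fixed \<open>z\<close> the inequality of \<open>minty_level_set\<close> describes a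
  closed half-space of points \<open>w\<close> (all of space if \<open>Q z = Q u\<close>), so the
  level set is \<open>U\<close> cut by an intersection of convex sets.\<close>

lemma convex_level_set:
  fixes Q :: "'a::euclidean_space \<Rightarrow> 'a"
  assumes U: "open U" "convex U" and Q: "continuous_on U Q" "law_of_demand U Q" and u: "u \<in> U"
  shows "convex {w \<in> U. Q w = Q u}"
proof -
  have "{w \<in> U. Q w = Q u} = U \<inter> (\<Inter>z\<in>U. {w. (Q z - Q u) \<bullet> w \<le> (Q z - Q u) \<bullet> z})"
    using minty_level_set[OF U(1) Q u] by (auto simp: inner_diff_right)
  then show ?thesis
    using U(2) by (auto intro!: convex_Int convex_INT convex_halfspace_le)
qed

lemma constant_segment_if_equal_values:
  fixes Q :: "'a::euclidean_space \<Rightarrow> 'a"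
  assumes "open U" "convex U" "continuous_on U Q" "law_of_demand U Q"
    and "u \<in> U" "u' \<in> U" "Q u' = Q u"
    and "w \<in> closed_segment u u'"
  shows "w \<in> U" "Q w = Q u"
proof -
  have "closed_segment u u' \<subseteq> {w \<in> U. Q w = Q u}"
    using assms convex_level_set by (intro closed_segment_subset) auto
  then show "w \<in> U" "Q w = Q u"
    using assms(8) by auto
qed

section \<open>Local uniqueness and constant segments\<close>

text \<open>A repeated value at a distant \<open>u'\<close> propagates along the whole segment from
  \<open>u\<close> to \<open>u'\<close>, and this segment enters every neighborhood of
  \<open>u\<close> at points other than \<open>u\<close>.\<close>

lemma uniquely_valued_iff_locally:
  fixes Q :: "'a::euclidean_space \<Rightarrow> 'a"
  assumes "open U" "convex U" "continuous_on U Q" "law_of_demand U Q" and u: "u \<in> U"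
  shows "uniquely_valued_at U Q u \<longleftrightarrow> locally_uniquely_valued_at U Q u"
proof
  assume "uniquely_valued_at U Q u"
  then show "locally_uniquely_valued_at U Q u"
    unfolding locally_uniquely_valued_at_def using assms interior_open by blast
next
  assume "locally_uniquely_valued_at U Q u"
  then obtain N where N: "u \<in> interior N" "uniquely_valued_at N Q u"
    unfolding locally_uniquely_valued_at_def by blast
  show "uniquely_valued_at U Q u"
    unfolding uniquely_valued_at_def
  proof (intro ballI impI notI)
    fix u' assume u': "u' \<in> U" "u \<noteq> u'" "Q u = Q u'"
    have line: "((\<lambda>t. u + t *\<^sub>R (u' - u)) \<longlongrightarrow> u) (at_right 0)"
      by (auto intro!: tendsto_eq_intros)
    \<comment> \<open>A small \<open>t\<close> puts the point in \<open>N\<close>,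
      \<open>t < 1\<close> keeps it on the segment, and \<open>0 < t\<close> separates it from
      \<open>u\<close>.\<close>
    have "\<forall>\<^sub>F t in at_right 0. u + t *\<^sub>R (u' - u) \<in> interior N \<and> 0 < t \<and> t < (1::real)"
      using topological_tendstoD[OF line open_interior N(1)]
        eventually_at_right_less[of 0] eventually_at_right_real[of 0 1]
      by (auto elim: eventually_elim2)
    then obtain t :: real where t: "u + t *\<^sub>R (u' - u) \<in> interior N" "0 < t" "t < 1"
      using eventually_happens'[OF trivial_limit_at_right_real] by blast
    have "u + t *\<^sub>R (u' - u) \<in> closed_segment u u'"
      using t by (auto simp: in_segment algebra_simps intro!: exI[of _ t])
    then have "Q (u + t *\<^sub>R (u' - u)) = Q u"
      by (rule constant_segment_if_equal_values(2)[OF assms u'(1) u'(3)[symmetric]])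
    moreover have "u \<noteq> u + t *\<^sub>R (u' - u)"
      using t(2) u'(2) by simp
    moreover have "u + t *\<^sub>R (u' - u) \<in> N"
      using t(1) interior_subset by blast
    ultimately show False
      using N(2) unfolding uniquely_valued_at_def by metis
  qed
qed

lemma uniquely_valued_iff_only_trivial_segment:
  fixes Q :: "'a::euclidean_space \<Rightarrow> 'a"
  assumes "open U" "convex U" "continuous_on U Q" "law_of_demand U Q" and u: "u \<in> U"
  shows "uniquely_valued_at U Q u \<longleftrightarrow> only_trivial_constant_segment_at U Q u"
proof
  assume uv: "uniquely_valued_at U Q u"
  \<comment> \<open>This settles one inclusion between the two families of segments; the other holds
    because the point \<open>u\<close> is itself the degenerate segment from \<open>u\<close> to
    \<open>u\<close>.\<close>
  have "S = {u}" if "S \<subseteq> U" "u \<in> S" "Q constant_on S" for S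
    using uv that unfolding uniquely_valued_at_def constant_on_def
    by (metis insertI1 singletonD subsetD subsetI subset_antisym)
  moreover have "{u} = closed_segment u u" "Q constant_on {u}"
    by (auto simp: constant_on_def)
  ultimately show "only_trivial_constant_segment_at U Q u"
    unfolding only_trivial_constant_segment_at_def using u by blast
next
  assume triv: "only_trivial_constant_segment_at U Q u"
  show "uniquely_valued_at U Q u"
    unfolding uniquely_valued_at_def
  proof (intro ballI impI notI)
    fix u' assume u': "u' \<in> U" "u \<noteq> u'" "Q u = Q u'"
    have "closed_segment u u' \<subseteq> U" "Q constant_on closed_segment u u'"
      using constant_segment_if_equal_values[OF assms u'(1) u'(3)[symmetric]]
      unfolding constant_on_def by blast+
    then have "closed_segment u u' = {u}"
      using triv unfolding only_trivial_constant_segment_at_def by blast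
    then show False
      using u'(2) by (metis ends_in_segment(2) singletonD)
  qed
qed

section \<open>Null directions\<close>

text \<open>The hypothesis on \<open>v\<close> controls only the right-hand difference quotient.
  Differentiability supplies a two-sided derivative \<open>D v\<close> along the line, and
  uniqueness of the right-hand limit identifies it with 0.\<close>

lemma zero_directional_derivative_imp_has_vector_derivative:
  fixes Q :: "'a::euclidean_space \<Rightarrow> 'a"
  assumes diff: "Q differentiable (at w)" and null: "has_directional_derivative Q w v 0"
  shows "((\<lambda>s. Q (w + s *\<^sub>R v)) has_vector_derivative 0) (at 0)"
proof -
  obtain D where "(Q has_derivative D) (at w)"
    using diff unfolding differentiable_def by blast
  \<comment> \<open>The base point is rewritten as the value at 0 of the inner map
    \<open>\<lambda>s. w + s *\<^sub>R v\<close>, the shape the chain rule expects.\<close>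
  then have D: "(Q has_derivative D) (at (w + 0 *\<^sub>R v))"
    by simp
  have "((\<lambda>s. w + s *\<^sub>R v) has_derivative (\<lambda>s. s *\<^sub>R v)) (at 0)"
    by (auto intro!: derivative_eq_intros)
  then have "((\<lambda>s. Q (w + s *\<^sub>R v)) has_derivative (\<lambda>s. D (s *\<^sub>R v))) (at 0)"
    using D by (rule has_derivative_compose)
  then have vec: "((\<lambda>s. Q (w + s *\<^sub>R v)) has_vector_derivative D v) (at 0)"
    using has_derivative_linear[OF D] by (simp add: has_vector_derivative_def linear_cmul)
  then have "((\<lambda>s. (Q (w + s *\<^sub>R v) - Q w - s *\<^sub>R D v) /\<^sub>R \<bar>s\<bar>) \<longlongrightarrow> 0) (at 0)"
    by (simp add: has_vector_derivative_def has_derivative_at_within)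
  then have "((\<lambda>s. (Q (w + s *\<^sub>R v) - Q w - s *\<^sub>R D v) /\<^sub>R \<bar>s\<bar>) \<longlongrightarrow> 0) (at_right 0)"
    by (rule filterlim_mono) (auto simp: at_le)
  \<comment> \<open>To the right of 0, \<open>\<bar>s\<bar> = s\<close>, so the normalized remainder
    is the difference quotient minus \<open>D v\<close>.\<close>
  moreover have "\<forall>\<^sub>F s in at_right 0. (Q (w + s *\<^sub>R v) - Q w - s *\<^sub>R D v) /\<^sub>R \<bar>s\<bar>
      = (Q (w + s *\<^sub>R v) - Q w) /\<^sub>R s - D v"
    using eventually_at_right_less[of 0] by eventually_elim (simp add: scaleR_diff_right)
  ultimately have "((\<lambda>s. (Q (w + s *\<^sub>R v) - Q w) /\<^sub>R s - D v) \<longlongrightarrow> 0) (at_right 0)"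
    by (rule Lim_transform_eventually)
  then have "((\<lambda>s. (Q (w + s *\<^sub>R v) - Q w) /\<^sub>R s) \<longlongrightarrow> D v) (at_right 0)"
    by (rule LIM_zero_cancel)
  then have "D v = 0"
    using null tendsto_unique[OF trivial_limit_at_right_real]
    unfolding has_directional_derivative_def by blast
  with vec show ?thesis
    by simp
qed

text \<open>Both directions translate between a null direction and a nondegenerate segment from
  \<open>u\<close> on which \<open>Q\<close> is constant: vanishing derivative along the segment
  gives constancy, and constancy makes the difference quotients vanish.\<close>

lemma uniquely_valued_iff_no_null_direction:
  fixes Q :: "'a::euclidean_space \<Rightarrow> 'a"
  assumes U: "open U" "convex U" and diff: "Q differentiable_on U" and mono: "law_of_demand U Q"
    and u: "u \<in> U"
  shows "uniquely_valued_at U Q u \<longleftrightarrow> no_null_direction_at U Q u"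
proof
  assume uv: "uniquely_valued_at U Q u"
  show "no_null_direction_at U Q u"
    unfolding no_null_direction_at_def
  proof (intro notI, elim exE conjE)
    fix v :: 'a
    assume v: "v \<noteq> 0"
      and null: "\<forall>t\<in>{0..1}. u + t *\<^sub>R v \<in> U \<longrightarrow> has_directional_derivative Q (u + t *\<^sub>R v) v 0"
    have line: "((\<lambda>t. u + t *\<^sub>R v) \<longlongrightarrow> u) (at_right 0)"
      by (auto intro!: tendsto_eq_intros)
    \<comment> \<open>The null condition speaks only of parameters in \<open>{0..1}\<close> whose
      points lie in \<open>U\<close>. Stopping at a small \<open>e < 1\<close> with endpoint in
      \<open>U\<close> lets convexity place all of \<open>{0..e}\<close> under that
      condition.\<close>
    have "\<forall>\<^sub>F t in at_right 0. u + t *\<^sub>R v \<in> U \<and> 0 < t \<and> t < (1::real)"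
      using topological_tendstoD[OF line U(1) u]
        eventually_at_right_less[of 0] eventually_at_right_real[of 0 1]
      by (auto elim: eventually_elim2)
    then obtain e :: real where e: "u + e *\<^sub>R v \<in> U" "0 < e" "e < 1"
      using eventually_happens'[OF trivial_limit_at_right_real] by blast
    have seg: "u + t *\<^sub>R v \<in> U" if "t \<in> {0..e}" for t
    proof -
      have "u + t *\<^sub>R v = (1 - t / e) *\<^sub>R u + (t / e) *\<^sub>R (u + e *\<^sub>R v)"
        using e by (simp add: algebra_simps)
      then show ?thesis
        using convexD[OF U(2) u e(1), of "1 - t / e" "t / e"] e that by auto
    qed
    have "((\<lambda>t. Q (u + t *\<^sub>R v)) has_derivative (\<lambda>h. 0)) (at t within {0..e})"
      if t: "t \<in> {0..e}" for t
    proof -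
      have "Q differentiable (at (u + t *\<^sub>R v))"
        using diff U(1) seg[OF t] differentiable_on_eq_differentiable_at by blast
      moreover have "has_directional_derivative Q (u + t *\<^sub>R v) v 0"
        using null seg[OF t] t e by auto
      \<comment> \<open>Writing the parameter 0 as \<open>t - t\<close> prepares the composition
        with the shift \<open>\<lambda>s. s - t\<close>, which carries the derivative at 0 over to
        the parameter \<open>t\<close>.\<close>
      ultimately have "((\<lambda>s. Q (u + t *\<^sub>R v + s *\<^sub>R v)) has_derivative (\<lambda>h. 0)) (at (t - t))"
        using zero_directional_derivative_imp_has_vector_derivative
        by (fastforce simp: has_vector_derivative_def)
      moreover have "((\<lambda>s. s - t) has_derivative (\<lambda>h. h)) (at t)"
        by (auto intro!: derivative_eq_intros)
      ultimately have "((\<lambda>s. Q (u + t *\<^sub>R v + (s - t) *\<^sub>R v)) has_derivative (\<lambda>h. 0)) (at t)"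
        by (rule has_derivative_compose[rotated])
      then show ?thesis
        by (simp add: algebra_simps has_derivative_at_withinI)
    qed
    then obtain c where "\<And>t. t \<in> {0..e} \<Longrightarrow> Q (u + t *\<^sub>R v) = c"
      using has_derivative_zero_constant[of "{0..e}" "\<lambda>t. Q (u + t *\<^sub>R v)"] by auto
    from this[of 0] this[of e] have "Q (u + e *\<^sub>R v) = Q u"
      using e by simp
    then show False
      using uv e v unfolding uniquely_valued_at_def by force
  qed
next
  assume no_null: "no_null_direction_at U Q u"
  have cont: "continuous_on U Q"
    using diff by (rule differentiable_imp_continuous_on)
  show "uniquely_valued_at U Q u"
    unfolding uniquely_valued_at_def
  proof (intro ballI impI notI)
    fix u' assume u': "u' \<in> U" "u \<noteq> u'" "Q u = Q u'"
    \<comment> \<open>Halving keeps the forward difference quotient at \<open>t = 1\<close> inside the constant segment.\<close>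
    define v where "v = (1/2) *\<^sub>R (u' - u)"
    have const: "Q (u + s *\<^sub>R v) = Q u" if "0 \<le> s" "s \<le> 2" for s
    proof -
      have "u + s *\<^sub>R v = (1 - s / 2) *\<^sub>R u + (s / 2) *\<^sub>R u'"
        by (simp add: v_def algebra_simps)
      then have "u + s *\<^sub>R v \<in> closed_segment u u'"
        unfolding in_segment using that by (intro exI[of _ "s / 2"]) auto
      then show ?thesis
        using constant_segment_if_equal_values[OF U cont mono u u'(1) u'(3)[symmetric]] by blast
    qed
    have "has_directional_derivative Q (u + t *\<^sub>R v) v 0" if t: "t \<in> {0..1}" for t
      unfolding has_directional_derivative_def
    proof (rule tendsto_eventually)
      show "\<forall>\<^sub>F s in at_right 0. (Q (u + t *\<^sub>R v + s *\<^sub>R v) - Q (u + t *\<^sub>R v)) /\<^sub>R s = 0"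
        using eventually_at_right_real[of 0 1, simplified]
      proof eventually_elim
        case (elim s)
        then show ?case
          using const[of "t + s"] const[of t] t by (simp add: scaleR_add_left add.assoc)
      qed
    qed
    moreover have "v \<noteq> 0"
      using u'(2) by (simp add: v_def)
    ultimately show False
      using no_null unfolding no_null_direction_at_def by blast
  qed
qed

section \<open>Local injectivity\<close>

lemma locally_injective_imp_locally_uniquely_valued:
  fixes Q :: "'a::euclidean_space \<Rightarrow> 'a"
  assumes "locally_injective_at U Q u"
  shows "locally_uniquely_valued_at U Q u"
proof -
  obtain N where N: "N \<subseteq> U" "u \<in> interior N" "inj_on Q N"
    using assms unfolding locally_injective_at_def by blast
  then have "uniquely_valued_at N Q u"
    unfolding uniquely_valued_at_def inj_on_def using interior_subset by blast
  with N show ?thesis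
    unfolding locally_uniquely_valued_at_def by blast
qed

text \<open>Unique values at all points of \<open>U\<close> amount to injectivity on
  \<open>U\<close>, so the open set \<open>U\<close> itself serves as the neighborhood.\<close>

lemma uniquely_valued_imp_locally_injective:
  fixes Q :: "'a::euclidean_space \<Rightarrow> 'a"
  assumes "open U" "\<And>w. w \<in> U \<Longrightarrow> uniquely_valued_at U Q w" "u \<in> U"
  shows "locally_injective_at U Q u"
  unfolding locally_injective_at_def
  using assms by (intro exI[of _ U]) (auto simp: inj_on_def uniquely_valued_at_def interior_open)

text \<open>At a single point, local injectivity implies unique valuation but not conversely: on the
  line, integrate from 0 a nonnegative continuous function that vanishes on intervals accumulating
  at 0 and is positive on others accumulating at 0 from both sides. The value at 0 is unique, yet
  flat pieces occur arbitrarily near 0. Hence the pointwise equivalence uses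
  \<open>locally_uniquely_valued_at\<close>, while \<open>locally_injective_at\<close> enters as a
  pointwise implication and as an equivalence quantified over all of \<open>U\<close>.\<close>

theorem proposition3:
  fixes U :: "(real ^ 'k) set" and Q :: "real ^ 'k \<Rightarrow> real ^ 'k"
  assumes "open U" and "convex U"
    and "Q differentiable_on U"
    and "law_of_demand U Q"
  shows "(\<forall>u\<in>U.
            (uniquely_valued_at U Q u \<longleftrightarrow> locally_uniquely_valued_at U Q u) \<and>
            (uniquely_valued_at U Q u \<longleftrightarrow> only_trivial_constant_segment_at U Q u) \<and>
            (uniquely_valued_at U Q u \<longleftrightarrow> no_null_direction_at U Q u) \<and>
            (locally_injective_at U Q u \<longrightarrow> uniquely_valued_at U Q u)) \<and>
         ((\<forall>u\<in>U. uniquely_valued_at U Q u) \<longleftrightarrow> (\<forall>u\<in>U. locally_injective_at U Q u)) \<and>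
         ((\<forall>u\<in>U. uniquely_valued_at U Q u) \<longleftrightarrow> (\<forall>u\<in>U. only_trivial_constant_segment_at U Q u)) \<and>
         ((\<forall>u\<in>U. uniquely_valued_at U Q u) \<longleftrightarrow> (\<forall>u\<in>U. no_null_direction_at U Q u))"
proof -
  have cont: "continuous_on U Q"
    using assms(3) by (rule differentiable_imp_continuous_on)
  note facts = uniquely_valued_iff_locally[OF assms(1,2) cont assms(4)]
    uniquely_valued_iff_only_trivial_segment[OF assms(1,2) cont assms(4)]
    uniquely_valued_iff_no_null_direction[OF assms]
  have "uniquely_valued_at U Q u" if "u \<in> U" "locally_injective_at U Q u" for u
    using that facts(1) locally_injective_imp_locally_uniquely_valued by blast
  then show ?thesis
    using facts uniquely_valued_imp_locally_injective[OF assms(1)] by blast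
qed

end
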